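(* Let $L \ge 3$ be an odd number. For $N \ge 2$ let $T^{F,L}_N$ denote the period of the F-type Grover walk with $L$ states on the cycle graph $C_N$. Then $T^{F,L}_L = 4$, and for every integer $N \ge 2$ such that $N$ has a factor $n \ge 2$ which is coprime to $L$, one has $T^{F,L}_N = \infty$.
   Context: Let $L \ge 3$ be odd, $m = (L-1)/2$, and $N \ge 2$. The cycle graph $C_N$ has vertex set $\{0,1,\dots,N-1\}$, with vertices identified modulo $N$. Let $\mathcal{H}_P$ be the complex Hilbert space with orthonormal basis $\{|k\rangle : k \in \{0,\dots,N-1\}\}$ (labels read modulo $N$), and let $\mathcal{H}_C$ be the complex Hilbert space with ordered orthonormal basis $(|\leftarrow m\rangle, \dots, |\leftarrow 1\rangle, |\cdot\rangle, |1\rightarrow\rangle, \dots, |m\rightarrow\rangle)$. Put $\mathcal{H} = \mathcal{H}_P \otimes \mathcal{H}_C$. The shift operator $S$ on $\mathcal{H}$ is the linear operator with $S(|k\rangle\otimes|\leftarrow j\rangle) = |k-j\rangle\otimes|\leftarrow j\rangle$ and $S(|k\rangle\otimes|j\rightarrow\rangle) = |k+j\rangle\otimes|j\rightarrow\rangle$ for $j=1,\dots,m$, and $S(|k\rangle\otimes|\cdot\rangle) = |k\rangle\otimes|\cdot\rangle$, where positions are read modulo $N$. The F-type local coin operator is the operator on $\mathcal{H}_C$ whose matrix $A^{F,L}$ in the ordered basis above is the $L\times L$ matrix with every anti-diagonal entry (position $(i, L+1-i)$) equal to $-(2m-1)/L$ and every other entry equal to $2/L$. The coin operator is $C = \sum_{k=0}^{N-1}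 |k\rangle\langle k| \otimes A^{F,L}$. The F-type Grover walk with $L$ states on $C_N$ is the quantum walk with time-evolution operator $U^{F,L}_N = SC$. Its period is $T^{F,L}_N = \inf\{ n \ge 1 : (U^{F,L}_N)^n = I\}$, defined to be $\infty$ if this set is empty. *)

theory Defs
  imports Complex_Main "HOL-Library.Extended_Nat" "Jordan_Normal_Form.Matrix"
begin

text \<open>
  Operators on a \<open>d\<close>-dimensional Hilbert space are complex \<open>d \<times> d\<close> matrices with respect to
  the distinguished orthonormal basis.  The space \<open>H\<^sub>P\<close> has dimension \<open>N\<close>, the space \<open>H\<^sub>C\<close> has
  dimension \<open>L\<close>, and \<open>H\<^sub>P \<otimes> H\<^sub>C\<close> is realised by the Kronecker product: the product of the
  \<open>k\<close>-th and the \<open>c\<close>-th basis vector (counting from 0) is the basis vector number \<open>k * L + c\<close>.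
\<close>

definition tensor_vec :: "complex vec \<Rightarrow> complex vec \<Rightarrow> complex vec" (infixl \<open>\<otimes>\<^sub>v\<close> 72) where
  "u \<otimes>\<^sub>v v = vec (dim_vec u * dim_vec v) (\<lambda>i. u $ (i div dim_vec v) * v $ (i mod dim_vec v))"

definition tensor_mat :: "complex mat \<Rightarrow> complex mat \<Rightarrow> complex mat" (infixl \<open>\<otimes>\<^sub>m\<close> 72) where
  "A \<otimes>\<^sub>m B = mat (dim_row A * dim_row B) (dim_col A * dim_col B)
     (\<lambda>(i, j). A $$ (i div dim_row B, j div dim_col B) * B $$ (i mod dim_row B, j mod dim_col B))"

text \<open>The operator written \<open>|u\<rangle>\<langle>v|\<close> in Dirac notation.\<close>

definition ketbra :: "complex vec \<Rightarrow> complex vec \<Rightarrow> complex mat" where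
  "ketbra u v = mat (dim_vec u) (dim_vec v) (\<lambda>(i, j). u $ i * cnj (v $ j))"

text \<open>Matrices of fixed size do not form a type, so their finite sums carry the dimension \<open>d\<close>.\<close>

definition op_sum :: "nat \<Rightarrow> ('i \<Rightarrow> complex mat) \<Rightarrow> 'i set \<Rightarrow> complex mat" where
  "op_sum d F I = mat d d (\<lambda>ij. \<Sum>i\<in>I. F i $$ ij)"

text \<open>Position labels are integers read modulo \<open>N\<close>.\<close>

definition pos_ket :: "nat \<Rightarrow> int \<Rightarrow> complex vec" where
  "pos_ket N k = unit_vec N (nat (k mod int N))"

text \<open>\<open>Leftward j\<close>, \<open>Stay\<close> and \<open>Rightward j\<close> are the labels \<open>\<leftarrow>j\<close>, \<open>\<cdot>\<close> and \<open>j\<rightarrow>\<close>; with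
  \<open>m = (L - 1) div 2\<close>, only those in \<open>coin_labels m\<close> are used.\<close>

datatype coin_label = Leftward nat | Stay | Rightward nat

definition coin_labels :: "nat \<Rightarrow> coin_label set" where
  "coin_labels m = Leftward ` {1..m} \<union> {Stay} \<union> Rightward ` {1..m}"

text \<open>Place (counting from 0) of a label in the ordered basis \<open>\<leftarrow>m, \<dots>, \<leftarrow>1, \<cdot>, 1\<rightarrow>, \<dots>, m\<rightarrow>\<close>.\<close>

fun coin_place :: "nat \<Rightarrow> coin_label \<Rightarrow> nat" where
  "coin_place m (Leftward j) = m - j"
| "coin_place m Stay = m"
| "coin_place m (Rightward j) = m + j"

definition coin_ket :: "nat \<Rightarrow> coin_label \<Rightarrow> complex vec" where
  "coin_ket L c = unit_vec L (coin_place ((L - 1) div 2) c)"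

fun displacement :: "coin_label \<Rightarrow> int" where
  "displacement (Leftward j) = - int j"
| "displacement Stay = 0"
| "displacement (Rightward j) = int j"

definition shift_op :: "nat \<Rightarrow> nat \<Rightarrow> complex mat" where
  "shift_op L N = op_sum (N * L)
     (\<lambda>(k, c). ketbra (pos_ket N (k + displacement c) \<otimes>\<^sub>v coin_ket L c) (pos_ket N k \<otimes>\<^sub>v coin_ket L c))
     ({0..<int N} \<times> coin_labels ((L - 1) div 2))"

text \<open>With rows and columns counted from 0, the anti-diagonal consists of the positions with
  \<open>i + j = L - 1\<close>.\<close>

definition F_local_coin :: "nat \<Rightarrow> complex mat" where
  "F_local_coin L = (let m = (L - 1) div 2 in
     mat L L (\<lambda>(i, j). if i + j = L - 1 then - ((2 * of_nat m - 1) / of_nat L) else 2 / of_nat L))"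

definition coin_op :: "nat \<Rightarrow> nat \<Rightarrow> complex mat" where
  "coin_op L N = op_sum (N * L)
     (\<lambda>k. ketbra (pos_ket N k) (pos_ket N k) \<otimes>\<^sub>m F_local_coin L) {0..<int N}"

definition F_walk :: "nat \<Rightarrow> nat \<Rightarrow> complex mat" where
  "F_walk L N = shift_op L N * coin_op L N"

text \<open>In \<open>enat\<close> the infimum of the empty set is \<open>\<infinity>\<close>.\<close>

definition F_period :: "nat \<Rightarrow> nat \<Rightarrow> enat" where
  "F_period L N = (INF n \<in> {n. n \<ge> 1 \<and> F_walk L N ^\<^sub>m n = 1\<^sub>m (N * L)}. enat n)"

lemma F_period_eq_infinity_iff:
  "F_period L N = \<infinity> \<longleftrightarrow> (\<forall>n\<ge>1. F_walk L N ^\<^sub>m n \<noteq> 1\<^sub>m (N * L))"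
proof
  assume *: "F_period L N = \<infinity>"
  show "\<forall>n\<ge>1. F_walk L N ^\<^sub>m n \<noteq> 1\<^sub>m (N * L)"
  proof (intro allI impI notI)
    fix n :: nat
    assume "n \<ge> 1" "F_walk L N ^\<^sub>m n = 1\<^sub>m (N * L)"
    then have "F_period L N \<le> enat n"
      unfolding F_period_def by (intro INF_lower) simp
    with * show False by simp
  qed
next
  assume "\<forall>n\<ge>1. F_walk L N ^\<^sub>m n \<noteq> 1\<^sub>m (N * L)"
  then have "{n. n \<ge> 1 \<and> F_walk L N ^\<^sub>m n = 1\<^sub>m (N * L)} = {}" by blast
  then show "F_period L N = \<infinity>"
    unfolding F_period_def by (simp only: image_empty Inf_empty top_enat_def)
qed

text \<open>\<open>shift_op\<close> acts on the product basis as the defining equations of the shift prescribe.\<close>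

lemma tensor_unit_vec:
  assumes "a < N" "b < L"
  shows "unit_vec N a \<otimes>\<^sub>v unit_vec L b = unit_vec (N * L) (a * L + b)"
proof
  show "dim_vec (unit_vec N a \<otimes>\<^sub>v unit_vec L b) = dim_vec (unit_vec (N * L) (a * L + b) :: complex vec)"
    by (simp add: tensor_vec_def)
next
  fix i assume "i < dim_vec (unit_vec (N * L) (a * L + b) :: complex vec)"
  then have i: "i < N * L" by simp
  then have L: "L > 0" by (cases L) auto
  have d: "i div L < N" using i by (simp add: less_mult_imp_div_less)
  have "i = a * L + b \<longleftrightarrow> i div L = a \<and> i mod L = b"
    using assms L by (auto simp: div_mult_mod_eq)
  then show "(unit_vec N a \<otimes>\<^sub>v unit_vec L b) $ i = (unit_vec (N * L) (a * L + b) :: complex vec) $ i"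
    using i d L assms by (auto simp: tensor_vec_def unit_vec_def)
qed

lemma shift_op_basis:
  assumes "odd L" "N \<ge> 1" "c \<in> coin_labels ((L - 1) div 2)"
  shows "shift_op L N *\<^sub>v (pos_ket N k \<otimes>\<^sub>v coin_ket L c)
    = pos_ket N (k + displacement c) \<otimes>\<^sub>v coin_ket L c"
proof -
  define m where "m = (L - 1) div 2"
  have L: "L = 2 * m + 1" using assms(1) by (auto simp: m_def elim!: oddE)
  define e where "e = (\<lambda>l b. nat (l mod int N) * L + coin_place m b)"
  define I where "I = {0..<int N} \<times> coin_labels m"
  have place: "coin_place m b < L" if "b \<in> coin_labels m" for b
    using that by (auto simp: coin_labels_def L)
  have pos: "nat (l mod int N) < N" for l :: int
    using assms(2) by (simp add: nat_less_iff)
  have basis: "pos_ket N l \<otimes>\<^sub>v coin_ket L b = unit_vec (N * L) (e l b)"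
    if "b \<in> coin_labels m" for l b
    using tensor_unit_vec[OF pos place[OF that], of l]
    by (simp add: pos_ket_def coin_ket_def e_def m_def)
  have e_less: "e l b < N * L" if "b \<in> coin_labels m" for l b
  proof -
    have "e l b < (nat (l mod int N) + 1) * L" using place[OF that] by (simp add: e_def)
    also have "\<dots> \<le> N * L" using pos[of l] by (intro mult_right_mono) auto
    finally show ?thesis .
  qed
  have place_inj: "b = b'" if "coin_place m b = coin_place m b'" "b \<in> coin_labels m" "b' \<in> coin_labels m" for b b'
    using that by (auto simp: coin_labels_def)
  have e_inj: "(l, b) = (k mod int N, c)" if "l \<in> {0..<int N}" "b \<in> coin_labels m" "e l b = e k c" for l b
  proof -
    have c: "c \<in> coin_labels m" using assms(3) by (simp add: m_def)
    have "e l b mod L = coin_place m b" "e k c mod L = coin_place m c"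
      using place[OF that(2)] place[OF c] by (simp_all add: e_def)
    moreover have "e l b div L = nat (l mod int N)" "e k c div L = nat (k mod int N)"
      using place[OF that(2)] place[OF c] by (simp_all add: e_def)
    ultimately have "coin_place m b = coin_place m c" "nat (l mod int N) = nat (k mod int N)"
      using that(3) by simp_all
    then show ?thesis using place_inj[OF _ that(2) c] that(1) assms(2)
      by (auto simp: eq_nat_nat_iff)
  qed
  have c: "c \<in> coin_labels m" using assms(3) by (simp add: m_def)
  have k: "(k mod int N, c) \<in> I" using c assms(2) by (simp add: I_def)
  have e_mod: "e (k mod int N + displacement c) c = e (k + displacement c) c"
    by (simp add: e_def mod_add_left_eq)
  have finI: "finite I" by (simp add: I_def coin_labels_def)
  have entry: "shift_op L N $$ (i, e k c) = unit_vec (N * L) (e (k + displacement c) c) $ i"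
    if i: "i < N * L" for i
  proof -
    have "shift_op L N $$ (i, e k c) = (\<Sum>(l, b)\<in>I.
        ketbra (unit_vec (N * L) (e (l + displacement b) b)) (unit_vec (N * L) (e l b)) $$ (i, e k c))"
      unfolding shift_op_def op_sum_def m_def[symmetric] I_def[symmetric]
      using i e_less[OF c] basis
      by (auto simp: I_def intro!: sum.cong)
    also have "\<dots> = (\<Sum>p\<in>I. if p = (k mod int N, c)
        then unit_vec (N * L) (e (k + displacement c) c) $ i else 0)"
    proof (rule sum.cong[OF refl])
      fix p assume p: "p \<in> I"
      obtain l b where lb: "p = (l, b)" by (cases p)
      have le: "e l b = e k c \<longleftrightarrow> (l, b) = (k mod int N, c)"
        using e_inj[of l b] p lb by (auto simp: I_def e_def)
      show "(case p of (l, b) \<Rightarrow> ketbra (unit_vec (N * L) (e (l + displacement b) b))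
          (unit_vec (N * L) (e l b)) $$ (i, e k c)) = (if p = (k mod int N, c)
        then unit_vec (N * L) (e (k + displacement c) c) $ i else 0)"
      proof (cases "(l, b) = (k mod int N, c)")
        case True
        then show ?thesis using i e_less[OF c] e_mod le lb
          by (auto simp: ketbra_def)
      next
        case False
        then have "e k c \<noteq> e l b" using le by metis
        then show ?thesis using False i e_less[OF c] e_less[of b l] p lb
          by (auto simp: ketbra_def I_def)
      qed
    qed
    also have "\<dots> = unit_vec (N * L) (e (k + displacement c) c) $ i"
      using k finI by simp
    finally show ?thesis .
  qed
  have carr: "shift_op L N \<in> carrier_mat (N * L) (N * L)"
    by (simp add: shift_op_def op_sum_def)
  have "shift_op L N *\<^sub>v unit_vec (N * L) (e k c) = unit_vec (N * L) (e (k + displacement c) c)"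
  proof
    fix i assume "i < dim_vec (unit_vec (N * L) (e (k + displacement c) c) :: complex vec)"
    then have i: "i < N * L" by simp
    have "(shift_op L N *\<^sub>v unit_vec (N * L) (e k c)) $ i = shift_op L N $$ (i, e k c)"
      using carr i e_less[OF c] by (simp add: scalar_prod_right_unit)
    then show "(shift_op L N *\<^sub>v unit_vec (N * L) (e k c)) $ i
      = unit_vec (N * L) (e (k + displacement c) c) $ i"
      using entry[OF i] by simp
  qed (use carr in simp)
  then show ?thesis using basis[OF c] by simp
qed

end

theory Submission
  imports Defs "HOL-Library.Periodic_Fun"
begin

text \<open>
  The local coin is \<open>(2/L) J - P\<close>, with \<open>J\<close> the all-ones matrix and \<open>P\<close> the reversal of the coin
  basis.  Since \<open>S (I \<otimes> P)\<close> is an involution, two steps of the walk change a state only by the coin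
  means of the state and of its image.  On \<open>C\<^sub>L\<close> these means average to the same constant, and the
  corrections of two consecutive double steps cancel, so the fourth power of the walk is the identity.

  Let \<open>M g x\<close> be the mean of \<open>g (x - j)\<close> over \<open>|j| \<le> m\<close>.  The walk sends a state
  \<open>h (x - j) - k x\<close> to the state of the same shape with \<open>(h, k)\<close> replaced by \<open>(2 M h - k, h)\<close>.
  Cleared of denominators, this is an integer recurrence which modulo \<open>L\<close> reads \<open>h' = 2 L M h\<close>;
  here \<open>L M\<close> is a sum over a window of length \<open>L\<close>, so if \<open>h'\<close> is constant modulo \<open>L\<close>, then \<open>h\<close> is
  \<open>L\<close>-periodic modulo \<open>L\<close>.  If \<open>h\<close> is also \<open>n\<close>-periodic with \<open>n\<close> coprime to \<open>L\<close>, it is constant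
  modulo \<open>L\<close>.  If some power of the walk were the identity, descent would make the initial \<open>h\<close>
  constant modulo \<open>L\<close>, which the indicator function of the multiples of \<open>n\<close> is not.
\<close>

section \<open>Amplitudes as functions of position and displacement\<close>

definition coin_mean :: "nat \<Rightarrow> (int \<Rightarrow> int \<Rightarrow> complex) \<Rightarrow> int \<Rightarrow> complex" where
  "coin_mean m \<psi> x = (\<Sum>j\<in>{-int m..int m}. \<psi> x j) / of_nat (2 * m + 1)"

text \<open>A coin label is encoded by its displacement \<open>j\<close>; values at \<open>|j| > m\<close> are junk.\<close>

definition walk_step :: "nat \<Rightarrow> (int \<Rightarrow> int \<Rightarrow> complex) \<Rightarrow> int \<Rightarrow> int \<Rightarrow> complex" where
  "walk_step m \<psi> x j = 2 * coin_mean m \<psi> (x - j) - \<psi> (x - j) (- j)"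

text \<open>Amplitudes live on all integers, so that wrapping around the cycle becomes periodicity
  in the position and the dynamics itself does not mention \<open>N\<close>. Subtracting
  \<open>m\<close> turns a place in the ordered coin basis into a displacement.\<close>

definition state_vec :: "nat \<Rightarrow> nat \<Rightarrow> (int \<Rightarrow> int \<Rightarrow> complex) \<Rightarrow> complex vec" where
  "state_vec m N \<psi> = vec (N * (2 * m + 1))
     (\<lambda>i. \<psi> (int (i div (2 * m + 1))) (int (i mod (2 * m + 1)) - int m))"

definition basis_index :: "nat \<Rightarrow> nat \<Rightarrow> int \<Rightarrow> int \<Rightarrow> nat" where
  "basis_index m N x j = nat (x mod int N) * (2 * m + 1) + nat (j + int m)"

section \<open>Periodic functions and window sums on the integers\<close>

lemma periodic_mod:
  fixes f :: "int \<Rightarrow> 'b"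
  assumes "periodic_fun_simple f p"
  shows "f (x mod p) = f x"
proof -
  interpret periodic_fun_simple f p by fact
  have "f (x mod p + of_int (x div p) * p) = f (x mod p)" by (rule plus_of_int)
  then show ?thesis by simp
qed

lemma periodic_cong_mod:
  fixes f :: "int \<Rightarrow> 'b"
  assumes "periodic_fun_simple f p" "x mod p = y mod p"
  shows "f x = f y"
  by (metis assms periodic_mod)

text \<open>By Bezout, 1 is an integer combination of \<open>p\<close> and \<open>q\<close>, so a
  unit translation is composed of translations by periods.\<close>

lemma periodic_coprime:
  fixes f :: "int \<Rightarrow> 'b"
  assumes p: "periodic_fun_simple f p" and q: "periodic_fun_simple f q" and "coprime p q"
  shows "f (x + 1) = f x"
proof -
  obtain a b where ab: "a * p + b * q = 1"
    using bezout_int[of p q] \<open>coprime p q\<close> by auto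
  have "f (x + 1) = f (x + a * p + b * q)" using ab by (simp add: add.assoc)
  also have "\<dots> = f (x + a * p)" by (rule periodic_cong_mod[OF q]) simp
  also have "\<dots> = f x" by (rule periodic_cong_mod[OF p]) simp
  finally show ?thesis .
qed

text \<open>The two windows differ only in an entering and a leaving term, which lie
  \<open>2 * m + 1\<close> apart. This distance ties the coin average to the number
  \<open>L\<close>, both on the cycle of length \<open>L\<close> and in the descent modulo
  \<open>L\<close>.\<close>

lemma sum_window_shift:
  fixes f :: "int \<Rightarrow> 'a::ab_group_add"
  shows "(\<Sum>j\<in>{-int m..int m}. f (x + 1 - j))
    = (\<Sum>j\<in>{-int m..int m}. f (x - j)) + f (x + 1 + int m) - f (x - int m)"
proof -
  define W where "W x = (\<Sum>j\<in>{x - int m..x + int m}. f j)" for x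
  have W: "(\<Sum>j\<in>{-int m..int m}. f (x - j)) = W x" for x
    unfolding W_def by (rule sum.reindex_bij_witness[of _ "\<lambda>j. x - j" "\<lambda>j. x - j"]) auto
  have "{x + 1 - int m..x + 1 + int m} = insert (x + 1 + int m) {x - int m + 1..x + int m}"
    "{x - int m..x + int m} = insert (x - int m) {x - int m + 1..x + int m}"
    by auto
  then show ?thesis unfolding W unfolding W_def by simp
qed

text \<open>For this period the entering term equals the leaving one, so the window sum has period 1
  and is constant. The first form serves sums over displacements at a fixed position, the second
  sums over positions at a fixed displacement.\<close>

lemma sum_window_periodic:
  fixes f :: "int \<Rightarrow> 'a::ab_group_add"
  assumes "periodic_fun_simple f (2 * int m + 1)"
  shows "(\<Sum>j\<in>{-int m..int m}. f (x - j)) = (\<Sum>j\<in>{-int m..int m}. f j)"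
    and "(\<Sum>j\<in>{-int m..int m}. f (j - x)) = (\<Sum>j\<in>{-int m..int m}. f j)"
proof -
  define W where "W x = (\<Sum>j\<in>{-int m..int m}. f (x - j))" for x
  interpret f: periodic_fun_simple f "2 * int m + 1" by fact
  have "f (x + 1 + int m) = f (x - int m)" for x
    using f.plus_1[of "x - int m"] by (simp add: algebra_simps)
  then interpret periodic_fun_simple W 1
    by unfold_locales (simp add: W_def sum_window_shift)
  have W: "W x = W 0" for x using plus_of_int[of 0 x] by simp
  have "W 0 = (\<Sum>j\<in>{-int m..int m}. f j)"
    unfolding W_def by (rule sum.reindex_bij_witness[of _ uminus uminus]) auto
  moreover have "W (- x) = (\<Sum>j\<in>{-int m..int m}. f (j - x))"
    unfolding W_def by (rule sum.reindex_bij_witness[of _ uminus uminus]) (auto simp: minus_diff_commute)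
  ultimately show "(\<Sum>j\<in>{-int m..int m}. f (x - j)) = (\<Sum>j\<in>{-int m..int m}. f j)"
    "(\<Sum>j\<in>{-int m..int m}. f (j - x)) = (\<Sum>j\<in>{-int m..int m}. f j)"
    using W[of x] W[of "- x"] by (simp_all add: W_def)
qed

lemma periodic_walk_step:
  assumes "periodic_fun_simple \<psi> p"
  shows "periodic_fun_simple (walk_step m \<psi>) p"
proof
  interpret periodic_fun_simple \<psi> p by fact
  have "\<psi> (x + p - j) = \<psi> (x - j)" for x j using plus_1[of "x - j"] by (simp add: algebra_simps)
  then show "walk_step m \<psi> (x + p) = walk_step m \<psi> x" for x
    by (simp add: walk_step_def coin_mean_def fun_eq_iff)
qed

lemma periodic_walk_power:
  assumes "periodic_fun_simple \<psi> p"
  shows "periodic_fun_simple ((walk_step m ^^ t) \<psi>) p"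
  by (induction t) (simp_all add: assms periodic_walk_step)

section \<open>Coordinates of the product basis and state vectors\<close>

lemma basis_index_less:
  assumes "N \<ge> 1" "j \<in> {-int m..int m}"
  shows "basis_index m N x j < N * (2 * m + 1)"
proof -
  have "nat (x mod int N) < N" using assms by (simp add: nat_less_iff)
  then have "(nat (x mod int N) + 1) * (2 * m + 1) \<le> N * (2 * m + 1)"
    by (intro mult_right_mono) auto
  then show ?thesis using assms by (auto simp: basis_index_def algebra_simps nat_less_iff)
qed

lemma basis_index_div_mod:
  assumes "j \<in> {-int m..int m}"
  shows "basis_index m N x j div (2 * m + 1) = nat (x mod int N)"
    and "basis_index m N x j mod (2 * m + 1) = nat (j + int m)"
proof -
  have "nat (j + int m) < 2 * m + 1" using assms by auto
  then show "basis_index m N x j div (2 * m + 1) = nat (x mod int N)"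
    and "basis_index m N x j mod (2 * m + 1) = nat (j + int m)"
    unfolding basis_index_def
    by (simp_all del: add_Suc_right add: div_add1_eq mod_add_eq)
qed

lemma basis_index_eq_iff:
  assumes "N \<ge> 1" "j \<in> {-int m..int m}" "l \<in> {-int m..int m}"
  shows "basis_index m N x j = basis_index m N y l \<longleftrightarrow> x mod int N = y mod int N \<and> j = l"
proof
  assume "basis_index m N x j = basis_index m N y l"
  then have "nat (x mod int N) = nat (y mod int N)" "nat (j + int m) = nat (l + int m)"
    using basis_index_div_mod[OF assms(2)] basis_index_div_mod[OF assms(3)] by metis+
  then show "x mod int N = y mod int N \<and> j = l"
    using assms by (auto simp: eq_nat_nat_iff)
qed (simp add: basis_index_def)

lemma basis_index_surj:
  assumes "i < N * (2 * m + 1)"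
  obtains x j where "0 \<le> x" "x < int N" "j \<in> {-int m..int m}" "i = basis_index m N x j"
proof
  have "i div (2 * m + 1) < N" using assms by (simp add: less_mult_imp_div_less)
  moreover have "i mod (2 * m + 1) \<le> 2 * m"
    using mod_less_divisor[of "2 * m + 1" i] by linarith
  moreover have "i = i div (2 * m + 1) * (2 * m + 1) + i mod (2 * m + 1)" by (rule div_mult_mod_eq[symmetric])
  ultimately show "0 \<le> int (i div (2 * m + 1))" "int (i div (2 * m + 1)) < int N"
    "int (i mod (2 * m + 1)) - int m \<in> {-int m..int m}"
    "i = basis_index m N (int (i div (2 * m + 1))) (int (i mod (2 * m + 1)) - int m)"
    by (simp_all add: basis_index_def del: mult_Suc_right add_Suc_right Suc_eq_plus1[symmetric])
qed

lemma state_vec_index: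
  assumes "N \<ge> 1" "periodic_fun_simple \<psi> (int N)" "j \<in> {-int m..int m}"
  shows "state_vec m N \<psi> $ basis_index m N x j = \<psi> x j"
  using assms basis_index_less[OF assms(1,3), of x] basis_index_div_mod[OF assms(3), of N x]
    periodic_mod[OF assms(2), of x]
  by (simp add: state_vec_def)

lemma state_vec_eqI:
  assumes "N \<ge> 1" "dim_vec v = N * (2 * m + 1)" "periodic_fun_simple \<psi> (int N)"
    and "\<And>x j. j \<in> {-int m..int m} \<Longrightarrow> v $ basis_index m N x j = \<psi> x j"
  shows "v = state_vec m N \<psi>"
proof
  fix i assume "i < dim_vec (state_vec m N \<psi>)"
  then have "i < N * (2 * m + 1)" by (simp add: state_vec_def)
  then obtain x j where "j \<in> {-int m..int m}" "i = basis_index m N x j"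
    by (rule basis_index_surj)
  then show "v $ i = state_vec m N \<psi> $ i"
    using assms state_vec_index by simp
qed (use assms in \<open>simp add: state_vec_def\<close>)

text \<open>Reading a vector through \<open>basis_index\<close> extends it periodically, so what
  holds for all periodic states holds for all vectors.\<close>

lemma state_vec_surj:
  assumes "N \<ge> 1" "v \<in> carrier_vec (N * (2 * m + 1))"
  obtains \<psi> where "periodic_fun_simple \<psi> (int N)" "v = state_vec m N \<psi>"
proof
  let ?\<psi> = "\<lambda>x j. v $ basis_index m N x j"
  show p: "periodic_fun_simple ?\<psi> (int N)"
    by unfold_locales (simp add: basis_index_def)
  show "v = state_vec m N ?\<psi>"
    using assms p by (intro state_vec_eqI) auto
qed

section \<open>Shift, coin and walk acting on states\<close>

lemma mat_entry_eq_mult_unit_vec: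
  fixes A :: "complex mat"
  assumes "A \<in> carrier_mat d d" "i < d" "j < d"
  shows "A $$ (i, j) = (A *\<^sub>v unit_vec d j) $ i"
  using assms by (simp add: scalar_prod_right_unit)

lemma shift_op_carrier: "shift_op L N \<in> carrier_mat (N * L) (N * L)"
  by (simp add: shift_op_def op_sum_def)

lemma coin_op_carrier: "coin_op L N \<in> carrier_mat (N * L) (N * L)"
  by (simp add: coin_op_def op_sum_def)

lemma F_walk_carrier: "F_walk L N \<in> carrier_mat (N * L) (N * L)"
  using shift_op_carrier coin_op_carrier unfolding F_walk_def by (rule mult_carrier_mat)

lemma shift_op_unit_vec:
  assumes "N \<ge> 1" "j \<in> {-int m..int m}"
  shows "shift_op (2 * m + 1) N *\<^sub>v unit_vec (N * (2 * m + 1)) (basis_index m N x j)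
    = unit_vec (N * (2 * m + 1)) (basis_index m N (x + j) j)"
proof -
  define c where "c = (if j < 0 then Leftward (nat (- j)) else if j = 0 then Stay else Rightward (nat j))"
  have c: "c \<in> coin_labels m" "displacement c = j" "coin_place m c = nat (j + int m)"
    using assms by (auto simp: c_def coin_labels_def image_iff Bex_def)
  have ket: "pos_ket N y \<otimes>\<^sub>v coin_ket (2 * m + 1) c = unit_vec (N * (2 * m + 1)) (basis_index m N y j)" for y
  proof -
    have "nat (y mod int N) < N" using assms by (simp add: nat_less_iff)
    moreover have "nat (j + int m) < 2 * m + 1" using assms by auto
    ultimately show ?thesis
      by (simp del: mult_Suc_right add: pos_ket_def coin_ket_def c tensor_unit_vec basis_index_def)
  qed
  show ?thesis
    using shift_op_basis[of "2 * m + 1" N c x, unfolded ket] assms(1) c by simp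
qed

text \<open>The shift permutes the basis, sending \<open>(x - j, j)\<close> to
  \<open>(x, j)\<close>; on coefficients a permutation acts through its inverse.\<close>

lemma shift_op_mult_vec:
  assumes "N \<ge> 1" "j \<in> {-int m..int m}" "v \<in> carrier_vec (N * (2 * m + 1))"
  shows "(shift_op (2 * m + 1) N *\<^sub>v v) $ basis_index m N x j = v $ basis_index m N (x - j) j"
proof -
  let ?d = "N * (2 * m + 1)" and ?S = "shift_op (2 * m + 1) N"
  let ?q = "basis_index m N (x - j) j"
  have S: "?S \<in> carrier_mat ?d ?d" by (rule shift_op_carrier)
  have i: "basis_index m N x j < ?d" using assms by (intro basis_index_less)
  have q: "?q < ?d" using assms by (intro basis_index_less)
  have entry: "?S $$ (basis_index m N x j, p) = (if p = ?q then 1 else 0)" if p: "p < ?d" for p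
  proof -
    obtain y l where yl: "l \<in> {-int m..int m}" "p = basis_index m N y l"
      using p by (rule basis_index_surj)
    have "?S $$ (basis_index m N x j, p) = (?S *\<^sub>v unit_vec ?d p) $ basis_index m N x j"
      using S i p by (rule mat_entry_eq_mult_unit_vec)
    also have "\<dots> = (if basis_index m N x j = basis_index m N (y + l) l then 1 else 0)"
      using shift_op_unit_vec[OF assms(1) yl(1), of y] basis_index_less[OF assms(1) yl(1), of "y + l"] i yl(2)
      by simp
    also have "basis_index m N x j = basis_index m N (y + l) l \<longleftrightarrow> p = ?q"
      unfolding yl(2) basis_index_eq_iff[OF assms(1,2) yl(1)] basis_index_eq_iff[OF assms(1) yl(1) assms(2)]
      by (auto simp: mod_eq_dvd_iff algebra_simps dvd_diff_commute)
    finally show ?thesis .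
  qed
  have "(?S *\<^sub>v v) $ basis_index m N x j = (\<Sum>p<?d. ?S $$ (basis_index m N x j, p) * v $ p)"
    using S i assms(3) by (simp add: scalar_prod_def lessThan_atLeast0)
  also have "\<dots> = (\<Sum>p<?d. if p = ?q then v $ p else 0)"
    using entry by (intro sum.cong refl) (simp del: mult_Suc_right)
  also have "\<dots> = v $ ?q" using q by simp
  finally show ?thesis .
qed

lemma coin_op_mult_vec:
  assumes "N \<ge> 1" "j \<in> {-int m..int m}" "v \<in> carrier_vec (N * (2 * m + 1))"
  shows "(coin_op (2 * m + 1) N *\<^sub>v v) $ basis_index m N x j
    = 2 * coin_mean m (\<lambda>x j. v $ basis_index m N x j) x - v $ basis_index m N x (- j)"
proof -
  let ?L = "2 * m + 1" and ?I = "{-int m..int m}"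
  let ?d = "N * ?L" and ?C = "coin_op ?L N" and ?i = "basis_index m N x j"
  have C: "?C \<in> carrier_mat ?d ?d" by (rule coin_op_carrier)
  have i: "?i < ?d" using assms by (intro basis_index_less)
  have entry: "?C $$ (?i, basis_index m N y l)
      = (if y mod int N = x mod int N then 2 / of_nat ?L - (if l = - j then 1 else 0) else 0)"
    if l: "l \<in> ?I" for y l
  proof -
    have p: "basis_index m N y l < ?d" using assms l by (intro basis_index_less)
    have "?C $$ (?i, basis_index m N y l) = (\<Sum>k\<in>{0..<int N}.
        if k = x mod int N then (if y mod int N = x mod int N then 
           F_local_coin ?L $$ (nat (j + int m), nat (l + int m)) else 0) else 0)"
      (is "_ = sum ?f _")
    proof -
      have "?C $$ (?i, basis_index m N y l) = (\<Sum>k\<in>{0..<int N}.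
          (ketbra (pos_ket N k) (pos_ket N k) \<otimes>\<^sub>m F_local_coin ?L) $$ (?i, basis_index m N y l))"
        unfolding coin_op_def op_sum_def using i p by (rule index_mat(1)[THEN trans]) simp
      also have "\<dots> = sum ?f {0..<int N}"
      proof (rule sum.cong[OF refl])
        fix k assume "k \<in> {0..<int N}"
        then have k: "k mod int N = k" "0 \<le> k" "nat k < N" by auto
        have F: "dim_row (F_local_coin ?L) = ?L" "dim_col (F_local_coin ?L) = ?L"
          by (simp_all add: F_local_coin_def Let_def)
        have K: "dim_row (ketbra (pos_ket N k) (pos_ket N k)) = N" "dim_col (ketbra (pos_ket N k) (pos_ket N k)) = N"
          by (simp_all add: ketbra_def pos_ket_def)
        have "nat (z mod int N) < N" for z using assms(1) by (simp add: nat_less_iff)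
        moreover from this have "unit_vec N (nat k) $ nat (z mod int N) = (if k = z mod int N then 1 else 0 :: complex)" for z
          using k(2) assms(1) unfolding index_unit_vec(1)[OF k(3) \<open>nat (z mod int N) < N\<close>]
          by (auto simp: eq_nat_nat_iff)
        ultimately have "ketbra (pos_ket N k) (pos_ket N k) $$ (nat (x mod int N), nat (y mod int N))
            = (if k = x mod int N \<and> y mod int N = x mod int N then 1 else 0)"
          using k(1) by (simp add: ketbra_def pos_ket_def)
        then show "(ketbra (pos_ket N k) (pos_ket N k) \<otimes>\<^sub>m F_local_coin ?L) $$ (?i, basis_index m N y l) = ?f k"
          unfolding tensor_mat_def F K index_mat(1)[OF i p] prod.case
            basis_index_div_mod[OF assms(2)] basis_index_div_mod[OF l] by simp
      qed
      finally show ?thesis .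
    qed
    also have "\<dots> = (if y mod int N = x mod int N then 
           F_local_coin ?L $$ (nat (j + int m), nat (l + int m)) else 0)"
      using assms by simp
    also have "F_local_coin ?L $$ (nat (j + int m), nat (l + int m)) = 2 / of_nat ?L - (if l = - j then 1 else 0)"
    proof -
      \<comment> \<open>In terms of displacements the anti-diagonal is \<open>l = - j\<close>, and
        its entry is the generic entry minus 1. This splits the coin into averaging and
        reversal.\<close>
      have "nat (j + int m) + nat (l + int m) = 2 * m \<longleftrightarrow> l = - j" using assms l by auto
      moreover have "- ((2 * of_nat m - 1) / of_nat ?L) = (2 / of_nat ?L - 1 :: complex)"
        by (simp add: divide_simps del: of_nat_Suc) simp
      moreover have "nat (j + int m) < ?L" "nat (l + int m) < ?L" using assms l by auto
      ultimately show ?thesis by (simp add: F_local_coin_def Let_def)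
    qed
    finally show ?thesis .
  qed
  have inj: "inj_on (basis_index m N x) ?I"
    using assms(1) by (intro inj_onI) (simp add: basis_index_eq_iff)
  have "(?C *\<^sub>v v) $ ?i = (\<Sum>p<?d. ?C $$ (?i, p) * v $ p)"
    using C i assms(3) by (simp add: scalar_prod_def lessThan_atLeast0)
  \<comment> \<open>The coin operator is block diagonal: row \<open>?i\<close> vanishes outside the
    block of position \<open>x\<close>.\<close>
  also have "\<dots> = (\<Sum>p\<in>basis_index m N x ` ?I. ?C $$ (?i, p) * v $ p)"
  proof (rule sum.mono_neutral_right)
    show "basis_index m N x ` ?I \<subseteq> {..<?d}" using basis_index_less[OF assms(1)] by blast
    show "\<forall>p\<in>{..<?d} - basis_index m N x ` ?I. ?C $$ (?i, p) * v $ p = 0"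
    proof
      fix p assume p: "p \<in> {..<?d} - basis_index m N x ` ?I"
      then obtain y l where yl: "l \<in> ?I" "p = basis_index m N y l"
        using basis_index_surj by (metis DiffD1 lessThan_iff)
      then have "y mod int N \<noteq> x mod int N" using p by (auto simp: basis_index_def)
      then show "?C $$ (?i, p) * v $ p = 0" using entry yl by simp
    qed
  qed simp
  also have "\<dots> = (\<Sum>l\<in>?I. 2 / of_nat ?L * v $ basis_index m N x l - (if l = - j then v $ basis_index m N x l else 0))"
    unfolding sum.reindex[OF inj] o_def
  proof (rule sum.cong[OF refl])
    fix l assume "l \<in> ?I"
    from entry[OF this, of x]
    show "?C $$ (?i, basis_index m N x l) * v $ basis_index m N x l
        = 2 / of_nat ?L * v $ basis_index m N x l - (if l = - j then v $ basis_index m N x l else 0)"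
      by (simp only: simp_thms if_True) (simp add: algebra_simps del: of_nat_Suc)
  qed
  also have "\<dots> = 2 * coin_mean m (\<lambda>x j. v $ basis_index m N x j) x - v $ basis_index m N x (- j)"
    using assms(2) by (simp add: sum_subtractf coin_mean_def sum_distrib_left sum_divide_distrib)
  finally show ?thesis .
qed

text \<open>The coin acts first; the shift then fetches its output in direction \<open>j\<close>
  from position \<open>x - j\<close>. This gives the mean there minus the amplitude with reversed
  displacement.\<close>

lemma F_walk_state_vec:
  assumes "N \<ge> 1" "periodic_fun_simple \<psi> (int N)"
  shows "F_walk (2 * m + 1) N *\<^sub>v state_vec m N \<psi> = state_vec m N (walk_step m \<psi>)"
proof (rule state_vec_eqI[OF assms(1)])
  let ?v = "state_vec m N \<psi>"
  have v: "?v \<in> carrier_vec (N * (2 * m + 1))" by (simp add: state_vec_def)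
  fix x j assume j: "j \<in> {-int m..int m}"
  have "F_walk (2 * m + 1) N *\<^sub>v ?v = shift_op (2 * m + 1) N *\<^sub>v (coin_op (2 * m + 1) N *\<^sub>v ?v)"
    unfolding F_walk_def using shift_op_carrier coin_op_carrier v by (rule assoc_mult_mat_vec)
  also have "\<dots> $ basis_index m N x j = (coin_op (2 * m + 1) N *\<^sub>v ?v) $ basis_index m N (x - j) j"
    using mult_mat_vec_carrier[OF coin_op_carrier v] by (rule shift_op_mult_vec[OF assms(1) j])
  also have "\<dots> = walk_step m \<psi> x j"
    unfolding coin_op_mult_vec[OF assms(1) j v] walk_step_def coin_mean_def
    using j by (simp add: state_vec_index[OF assms])
  finally show "(F_walk (2 * m + 1) N *\<^sub>v ?v) $ basis_index m N x j = walk_step m \<psi> x j" .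
next
  show "dim_vec (F_walk (2 * m + 1) N *\<^sub>v state_vec m N \<psi>) = N * (2 * m + 1)"
    using F_walk_carrier[of "2 * m + 1" N] by simp
qed (rule periodic_walk_step[OF assms(2)])

lemma F_walk_power_state_vec:
  assumes "N \<ge> 1" "periodic_fun_simple \<psi> (int N)"
  shows "(F_walk (2 * m + 1) N ^\<^sub>m t) *\<^sub>v state_vec m N \<psi> = state_vec m N ((walk_step m ^^ t) \<psi>)"
  using assms(2)
\<comment> \<open>\<open>?U ^\<^sub>m Suc t\<close> has its extra factor on the right, so the first
  step is peeled off and the hypothesis is applied to \<open>walk_step m \<psi>\<close>.\<close>
proof (induction t arbitrary: \<psi>)
  case 0
  then show ?case using F_walk_carrier[of "2 * m + 1" N] by (simp add: state_vec_def)
next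
  case (Suc t)
  let ?U = "F_walk (2 * m + 1) N" and ?d = "N * (2 * m + 1)"
  have U: "?U \<in> carrier_mat ?d ?d" by (rule F_walk_carrier)
  have v: "state_vec m N \<psi> \<in> carrier_vec ?d" by (simp add: state_vec_def)
  have "(?U ^\<^sub>m Suc t) *\<^sub>v state_vec m N \<psi> = (?U ^\<^sub>m t) *\<^sub>v (?U *\<^sub>v state_vec m N \<psi>)"
    using assoc_mult_mat_vec[OF pow_carrier_mat[OF U] U v] by simp
  also have "\<dots> = state_vec m N ((walk_step m ^^ t) (walk_step m \<psi>))"
    using Suc periodic_walk_step F_walk_state_vec[OF assms(1)] by metis
  finally show ?case by (simp add: funpow_swap1)
qed

text \<open>This is the bridge from matrices to functions: periodic amplitudes yield every vector,
  and a vector determines its amplitudes at displacements within the window.\<close>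

lemma F_walk_power_eq_one_iff:
  assumes "N \<ge> 1"
  shows "F_walk (2 * m + 1) N ^\<^sub>m t = 1\<^sub>m (N * (2 * m + 1)) \<longleftrightarrow>
    (\<forall>(\<psi> :: int \<Rightarrow> int \<Rightarrow> complex) x. \<forall>j\<in>{-int m..int m}. periodic_fun_simple \<psi> (int N) \<longrightarrow> (walk_step m ^^ t) \<psi> x j = \<psi> x j)"
    (is "?A = 1\<^sub>m ?d \<longleftrightarrow> ?R")
proof
  assume one: "?A = 1\<^sub>m ?d"
  show ?R
  proof (intro allI ballI impI)
    fix \<psi> :: "int \<Rightarrow> int \<Rightarrow> complex" and x j
    assume j: "j \<in> {-int m..int m}" and p: "periodic_fun_simple \<psi> (int N)"
    have "state_vec m N \<psi> \<in> carrier_vec ?d" by (simp add: state_vec_def)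
    then have "state_vec m N ((walk_step m ^^ t) \<psi>) = state_vec m N \<psi>"
      using F_walk_power_state_vec[OF assms p, of m t] one by simp
    then show "(walk_step m ^^ t) \<psi> x j = \<psi> x j"
      using state_vec_index[OF assms periodic_walk_power[OF p] j] state_vec_index[OF assms p j] by metis
  qed
next
  assume R: ?R
  have A: "?A \<in> carrier_mat ?d ?d" by (rule pow_carrier_mat[OF F_walk_carrier])
  have id: "?A *\<^sub>v v = v" if v: "v \<in> carrier_vec ?d" for v
  proof -
    obtain \<psi> where p: "periodic_fun_simple \<psi> (int N)" and v: "v = state_vec m N \<psi>"
      using state_vec_surj[OF assms v] by blast
    have "state_vec m N ((walk_step m ^^ t) \<psi>) = state_vec m N \<psi>"
    proof (rule state_vec_eqI[OF assms _ p])
      show "dim_vec (state_vec m N ((walk_step m ^^ t) \<psi>)) = ?d" by (simp add: state_vec_def)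
    qed (use R p state_vec_index[OF assms periodic_walk_power[OF p]] in auto)
    then show ?thesis unfolding v F_walk_power_state_vec[OF assms p] .
  qed
  show "?A = 1\<^sub>m ?d"
  proof (rule eq_matI)
    fix i j assume "i < dim_row (1\<^sub>m ?d :: complex mat)" "j < dim_col (1\<^sub>m ?d :: complex mat)"
    then have ij: "i < ?d" "j < ?d" by auto
    have "?A $$ (i, j) = (?A *\<^sub>v unit_vec ?d j) $ i"
      using A ij by (rule mat_entry_eq_mult_unit_vec)
    also have "\<dots> = 1\<^sub>m ?d $$ (i, j)"
      unfolding id[OF unit_vec_carrier] using ij by simp
    finally show "?A $$ (i, j) = 1\<^sub>m ?d $$ (i, j)" .
  qed (use A in auto)
qed

section \<open>Period 4 on the cycle of length \<open>L\<close>\<close>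

text \<open>The reversal at \<open>x - j\<close> with displacement \<open>- j\<close> leads back to
  position \<open>x\<close> and displacement \<open>j\<close>, so the reversed parts compose to
  \<open>\<psi>\<close> itself and only means remain.\<close>

lemma walk_step_twice:
  "walk_step m (walk_step m \<psi>) x j
    = 2 * coin_mean m (walk_step m \<psi>) (x - j) - 2 * coin_mean m \<psi> x + \<psi> x j"
  by (simp add: walk_step_def[of m "walk_step m \<psi>"] walk_step_def[of m \<psi> "x - j"])

lemma periodic_coin_mean:
  assumes "periodic_fun_simple \<psi> p"
  shows "periodic_fun_simple (coin_mean m \<psi>) p"
proof
  interpret periodic_fun_simple \<psi> p by fact
  show "coin_mean m \<psi> (x + p) = coin_mean m \<psi> x" for x
    by (simp add: coin_mean_def plus_1)
qed

text \<open>Over a full period the translations by \<open>j\<close> drop out. If \<open>T\<close> is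
  the total of the means, the averaging part contributes \<open>2 * ?L * T\<close> and the reversal
  takes away \<open>?L * T\<close>.\<close>

lemma total_walk_step:
  assumes p: "periodic_fun_simple \<psi> (2 * int m + 1)"
  shows "(\<Sum>x\<in>{-int m..int m}. coin_mean m (walk_step m \<psi>) x) = (\<Sum>x\<in>{-int m..int m}. coin_mean m \<psi> x)"
proof -
  let ?I = "{-int m..int m}" and ?L = "of_nat (2 * m + 1) :: complex"
  have L: "?L \<noteq> 0" by (metis of_nat_eq_0_iff add_is_0 one_neq_zero)
  have coin: "periodic_fun_simple (\<lambda>x. \<psi> x j) (2 * int m + 1)" for j
  proof -
    interpret periodic_fun_simple \<psi> "2 * int m + 1" by fact
    show ?thesis by unfold_locales (simp add: plus_1)
  qed
  have total: "(\<Sum>x\<in>?I. \<Sum>j\<in>?I. \<psi> x j) = ?L * (\<Sum>x\<in>?I. coin_mean m \<psi> x)"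
    using L by (simp add: coin_mean_def flip: sum_divide_distrib)
  have "?L * (\<Sum>x\<in>?I. coin_mean m (walk_step m \<psi>) x) = (\<Sum>x\<in>?I. \<Sum>j\<in>?I. walk_step m \<psi> x j)"
    using L by (simp add: coin_mean_def flip: sum_divide_distrib)
  also have "\<dots> = (\<Sum>j\<in>?I. 2 * (\<Sum>x\<in>?I. coin_mean m \<psi> (x - j)) - (\<Sum>x\<in>?I. \<psi> (x - j) (- j)))"
    by (subst sum.swap) (simp add: walk_step_def sum_subtractf sum_distrib_left)
  also have "\<dots> = (\<Sum>j\<in>?I. 2 * (\<Sum>x\<in>?I. coin_mean m \<psi> x) - (\<Sum>x\<in>?I. \<psi> x (- j)))"
    by (simp only: sum_window_periodic(2)[OF periodic_coin_mean[OF p]] sum_window_periodic(2)[OF coin])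
  also have "\<dots> = 2 * ?L * (\<Sum>x\<in>?I. coin_mean m \<psi> x) - (\<Sum>j\<in>?I. \<Sum>x\<in>?I. \<psi> x (- j))"
    by (simp add: sum_subtractf algebra_simps)
  also have "(\<Sum>j\<in>?I. \<Sum>x\<in>?I. \<psi> x (- j)) = (\<Sum>j\<in>?I. \<Sum>x\<in>?I. \<psi> x j)"
    by (rule sum.reindex_bij_witness[of _ uminus uminus]) auto
  also have "\<dots> = ?L * (\<Sum>x\<in>?I. coin_mean m \<psi> x)"
    using total by (subst sum.swap) simp
  finally have "?L * (\<Sum>x\<in>?I. coin_mean m (walk_step m \<psi>) x) = ?L * (\<Sum>x\<in>?I. coin_mean m \<psi> x)"
    by simp
  then show ?thesis using L by (metis mult_left_cancel)
qed

text \<open>Averaging \<open>walk_step_twice\<close> over \<open>j\<close> lets its first term run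
  over a full period, where \<open>total_walk_step\<close> applies. Two steps thus reflect each mean
  in the average of all means.\<close>

lemma coin_mean_walk_step_twice:
  assumes p: "periodic_fun_simple \<psi> (2 * int m + 1)"
  shows "coin_mean m (walk_step m (walk_step m \<psi>)) x
    = 2 * (\<Sum>y\<in>{-int m..int m}. coin_mean m \<psi> y) / of_nat (2 * m + 1) - coin_mean m \<psi> x"
proof -
  let ?I = "{-int m..int m}" and ?L = "of_nat (2 * m + 1) :: complex"
  have L: "?L \<noteq> 0" by (metis of_nat_eq_0_iff add_is_0 one_neq_zero)
  have "coin_mean m (walk_step m (walk_step m \<psi>)) x
      = (2 * (\<Sum>j\<in>?I. coin_mean m (walk_step m \<psi>) (x - j)) - ?L * (2 * coin_mean m \<psi> x)
        + (\<Sum>j\<in>?I. \<psi> x j)) / ?L"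
    unfolding coin_mean_def[of m "walk_step m (walk_step m \<psi>)"] walk_step_twice
    by (simp add: sum.distrib sum_subtractf sum_distrib_left)
  also have "(\<Sum>j\<in>?I. coin_mean m (walk_step m \<psi>) (x - j)) = (\<Sum>y\<in>?I. coin_mean m \<psi> y)"
    using sum_window_periodic(1)[OF periodic_coin_mean[OF periodic_walk_step[OF p]]] total_walk_step[OF p]
    by metis
  also have "(\<Sum>j\<in>?I. \<psi> x j) = ?L * coin_mean m \<psi> x"
    using L by (simp add: coin_mean_def)
  finally show ?thesis using L by (simp add: field_simps del: of_nat_Suc of_nat_add)
qed

lemma walk_power_4:
  assumes p: "periodic_fun_simple \<psi> (2 * int m + 1)"
  shows "(walk_step m ^^ 4) \<psi> x j = \<psi> x j"
proof -
  have "(walk_step m ^^ 4) \<psi> x j = walk_step m (walk_step m (walk_step m (walk_step m \<psi>))) x j"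
    by (simp add: eval_nat_numeral)
  then show ?thesis
    \<comment> \<open>By \<open>total_walk_step\<close> the means of \<open>\<psi>\<close> and of
      \<open>walk_step m \<psi>\<close> are reflected in the same constant. It cancels in the second
      correction, which is then the negative of the first.\<close>
    unfolding walk_step_twice[of m "walk_step m (walk_step m \<psi>)"]
      coin_mean_walk_step_twice[OF p] coin_mean_walk_step_twice[OF periodic_walk_step[OF p]]
      total_walk_step[OF p] walk_step_twice[of m \<psi>]
    by (simp add: algebra_simps)
qed

text \<open>The witness is concentrated at the origin and uniform in the coin. Its mean at 0 is 1,
  and \<open>1 / L\<close> one step later, so after two steps the amplitude 1 has become
  \<open>2 / L - 1\<close>.\<close>

lemma walk_power_2_nontrivial:
  assumes "m \<ge> 1"
  shows "\<exists>\<psi>. periodic_fun_simple \<psi> (2 * int m + 1) \<and> (walk_step m ^^ 2) \<psi> 0 0 \<noteq> \<psi> 0 0"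
proof (intro exI conjI)
  let ?I = "{-int m..int m}" and ?L = "of_nat (2 * m + 1) :: complex"
  define \<psi> :: "int \<Rightarrow> int \<Rightarrow> complex" where
    "\<psi> = (\<lambda>x j. if x mod (2 * int m + 1) = 0 then 1 else 0)"
  show "periodic_fun_simple \<psi> (2 * int m + 1)"
    by unfold_locales (simp add: \<psi>_def)
  have L: "?L \<noteq> 0" by (metis of_nat_eq_0_iff add_is_0 one_neq_zero)
  have mean: "coin_mean m \<psi> x = \<psi> x 0" for x
    using L by (simp add: coin_mean_def \<psi>_def)
  have \<psi>: "\<psi> (- j) k = (if j = 0 then 1 else 0)" if "j \<in> ?I" for j k
  proof -
    have "- j mod (2 * int m + 1) = 0 \<longleftrightarrow> j = 0"
      using that dvd_imp_le_int[of j "2 * int m + 1"] by (cases "j = 0") (auto simp: mod_eq_0_iff_dvd)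
    then show ?thesis by (simp add: \<psi>_def)
  qed
  have "(\<Sum>j\<in>?I. walk_step m \<psi> 0 j) = (\<Sum>j\<in>?I. if j = 0 then 1 else 0)"
    by (intro sum.cong) (auto simp: walk_step_def mean \<psi>)
  then have "coin_mean m (walk_step m \<psi>) 0 = 1 / ?L" by (simp add: coin_mean_def)
  moreover have "1 / ?L \<noteq> 1"
    using L assms by (simp add: divide_simps)
  moreover have "(walk_step m ^^ 2) \<psi> 0 0 = 2 * coin_mean m (walk_step m \<psi>) 0 - 1" "\<psi> 0 0 = 1"
    using \<psi>[of 0] by (simp_all add: eval_nat_numeral walk_step_twice mean)
  ultimately show "(walk_step m ^^ 2) \<psi> 0 0 \<noteq> \<psi> 0 0"
    by (metis add_diff_cancel diff_add_cancel mult_2 mult_cancel_left one_add_one zero_neq_numeral)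
qed

text \<open>Exponent 2 fails by the witness, and this excludes exponent 1. Exponent 3 would,
  together with exponent 4, make the walk itself the identity.\<close>

lemma F_period_diagonal:
  assumes "m \<ge> 1"
  shows "F_period (2 * m + 1) (2 * m + 1) = 4"
proof -
  let ?L = "2 * m + 1"
  let ?A = "F_walk ?L ?L" and ?d = "?L * ?L"
  have L: "?L \<ge> 1" "int ?L = 2 * int m + 1" by simp_all
  have A: "?A \<in> carrier_mat ?d ?d" by (rule F_walk_carrier)
  have four: "?A ^\<^sub>m 4 = 1\<^sub>m ?d"
    unfolding F_walk_power_eq_one_iff[OF L(1)] L(2) using walk_power_4 by blast
  have two: "?A ^\<^sub>m 2 \<noteq> 1\<^sub>m ?d"
    unfolding F_walk_power_eq_one_iff[OF L(1)] L(2) using walk_power_2_nontrivial[OF assms] by fastforce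
  have one: "?A \<noteq> 1\<^sub>m ?d"
  proof
    assume "?A = 1\<^sub>m ?d"
    then have "?A ^\<^sub>m 2 = 1\<^sub>m ?d" by (simp add: eval_nat_numeral)
    with two show False by contradiction
  qed
  have "?A ^\<^sub>m 4 = ?A ^\<^sub>m 3 * ?A" by (simp add: eval_nat_numeral)
  then have three: "?A ^\<^sub>m 3 \<noteq> 1\<^sub>m ?d" using four one A by auto
  have least: "4 \<le> n" if "n \<ge> 1" "?A ^\<^sub>m n = 1\<^sub>m ?d" for n
  proof (rule ccontr)
    assume "\<not> 4 \<le> n"
    with that(1) consider "n = 1" | "n = 2" | "n = 3" by linarith
    then show False using that(2) one two three A by cases auto
  qed
  show ?thesis
  proof (rule antisym)
    have "F_period ?L ?L \<le> enat 4"
      unfolding F_period_def using four by (intro INF_lower) simp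
    then show "F_period ?L ?L \<le> 4" by (simp add: numeral_eq_enat)
    have "enat 4 \<le> F_period ?L ?L"
      unfolding F_period_def using least by (intro INF_greatest) auto
    then show "4 \<le> F_period ?L ?L" by (simp add: numeral_eq_enat)
  qed
qed

section \<open>Infinite period by descent modulo \<open>L\<close>\<close>

text \<open>\<open>scaled_amp m g (t + 1) / L\<^sup>t\<close> is the \<open>h\<close> reached after \<open>t\<close> steps from \<open>(h, k) = (g, 0)\<close>.\<close>

fun scaled_amp :: "nat \<Rightarrow> (int \<Rightarrow> int) \<Rightarrow> nat \<Rightarrow> int \<Rightarrow> int" where
  "scaled_amp m g 0 x = 0"
| "scaled_amp m g (Suc 0) x = g x"
| "scaled_amp m g (Suc (Suc t)) x =
     2 * (\<Sum>j\<in>{-int m..int m}. scaled_amp m g (Suc t) (x - j)) - (2 * int m + 1)\<^sup>2 * scaled_amp m g t x"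

lemma periodic_scaled_amp:
  assumes "periodic_fun_simple g p"
  shows "periodic_fun_simple (scaled_amp m g t) p"
proof
  interpret periodic_fun_simple g p by fact
  have eq: "x + p - j = x - j + p" for x j :: int by simp
  show "scaled_amp m g t (x + p) = scaled_amp m g t x" for x
    by (induction t arbitrary: x rule: induct_nat_012) (simp_all add: plus_1 eq)
qed

text \<open>The state keeps the shape \<open>h (x - j) - k x\<close>. Here \<open>k\<close> is the
  \<open>h\<close> of one step earlier, so over the common denominator it carries an extra factor
  \<open>L\<close>; the value 0 at index 0 encodes the initial \<open>k = 0\<close>.\<close>

lemma walk_power_scaled_amp:
  "(walk_step m ^^ t) (\<lambda>x j. of_int (g (x - j))) x j
    = of_int (scaled_amp m g (Suc t) (x - j) - (2 * int m + 1) * scaled_amp m g t x) / of_nat (2 * m + 1) ^ t"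
proof (induction t arbitrary: x j)
  case (Suc t)
  let ?L = "of_nat (2 * m + 1) :: complex"
  have L: "?L \<noteq> 0" by (metis of_nat_eq_0_iff add_is_0 one_neq_zero)
  have LI: "of_int (2 * int m + 1) = ?L" by simp
  define \<psi> where "\<psi> = (walk_step m ^^ t) (\<lambda>x j. complex_of_int (g (x - j)))"
  define q where "q = (\<lambda>t x. complex_of_int (scaled_amp m g t x))"
  have \<psi>: "\<psi> x j = (q (Suc t) (x - j) - ?L * q t x) / ?L ^ t" for x j
    unfolding \<psi>_def Suc.IH q_def LI[symmetric] by simp
  have q: "q (Suc (Suc t)) x = 2 * (\<Sum>j\<in>{-int m..int m}. q (Suc t) (x - j)) - ?L\<^sup>2 * q t x" for x
    unfolding q_def LI[symmetric] by simp
  have mean: "?L * coin_mean m \<psi> x = ((\<Sum>j\<in>{-int m..int m}. q (Suc t) (x - j)) - ?L\<^sup>2 * q t x) / ?L ^ t" for x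
    using L unfolding coin_mean_def \<psi> by (simp add: sum_subtractf power2_eq_square flip: sum_divide_distrib)
  have "?L * walk_step m \<psi> x j = 2 * (?L * coin_mean m \<psi> (x - j)) - ?L * \<psi> (x - j) (- j)"
    by (simp add: walk_step_def algebra_simps)
  \<comment> \<open>The mean subtracts \<open>?L\<^sup>2 * q t (x - j)\<close> twice and the
    reversed term restores it once, as the recurrence demands; the reversal also moves
    \<open>q (Suc t)\<close> from \<open>x - j\<close> to \<open>x\<close>.\<close>
  also have "\<dots> = (q (Suc (Suc t)) (x - j) - ?L * q (Suc t) x) / ?L ^ t"
    unfolding mean \<psi> q by (simp add: field_simps power2_eq_square del: of_nat_Suc of_nat_add)
  finally have "walk_step m \<psi> x j = (q (Suc (Suc t)) (x - j) - ?L * q (Suc t) x) / ?L ^ Suc t"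
    using L by (simp add: field_simps del: of_nat_Suc of_nat_add)
  then show ?case unfolding \<psi>_def q_def LI[symmetric] by simp
qed simp

text \<open>Differencing the recurrence leaves, modulo \<open>L\<close>, twice the entering minus
  the leaving term. As 2 is invertible modulo the odd \<open>L\<close>, the residues of the earlier
  amplitude have period \<open>L\<close> besides \<open>p\<close>, and coprimality makes them
  constant.\<close>

lemma scaled_amp_descent:
  fixes p :: int and m :: nat
  defines "L \<equiv> 2 * int m + 1"
  assumes g: "periodic_fun_simple g p" and "coprime p L"
    and dvd: "\<And>x. L dvd scaled_amp m g (Suc (Suc t)) (x + 1) - scaled_amp m g (Suc (Suc t)) x"
  shows "L dvd scaled_amp m g (Suc t) (x + 1) - scaled_amp m g (Suc t) x"
proof -
  define q where "q = scaled_amp m g (Suc t)"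
  have q: "L dvd q (x + L) - q x" for x
  proof -
    \<comment> \<open>Centring the window here puts the leaving term at \<open>x\<close> and the
      entering term at \<open>x + L\<close>.\<close>
    define y where "y = x + int m"
    have "scaled_amp m g (Suc (Suc t)) (y + 1) - scaled_amp m g (Suc (Suc t)) y
        = 2 * (q (y + 1 + int m) - q (y - int m)) - L * (L * (scaled_amp m g t (y + 1) - scaled_amp m g t y))"
      using sum_window_shift[of q y m] by (simp add: q_def L_def algebra_simps power2_eq_square)
    then have "L dvd 2 * (q (y + 1 + int m) - q (y - int m))"
      using dvd[of y] by (metis dvd_diff_right_iff dvd_triv_left dvd_diff dvd_add_left_iff diff_conv_add_uminus dvd_minus_iff)
    moreover have "coprime L 2" by (simp add: L_def)
    ultimately have "L dvd q (y + 1 + int m) - q (y - int m)" by (rule coprime_dvd_mult_right_iff[THEN iffD1, rotated])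
    moreover have "y + 1 + int m = x + L" "y - int m = x" by (simp_all add: y_def L_def)
    ultimately show ?thesis by simp
  qed
  \<comment> \<open>Passing to residues gives one function with both periods: \<open>q\<close>
    itself is periodic with \<open>p\<close>, but with \<open>L\<close> only modulo
    \<open>L\<close>.\<close>
  have "periodic_fun_simple (\<lambda>x. q x mod L) L"
    using q by unfold_locales (simp add: mod_eq_dvd_iff)
  moreover have "periodic_fun_simple (\<lambda>x. q x mod L) p"
  proof -
    interpret periodic_fun_simple q p unfolding q_def using g by (rule periodic_scaled_amp)
    show ?thesis by unfold_locales (simp add: plus_1)
  qed
  ultimately have "q (x + 1) mod L = q x mod L"
    using periodic_coprime[of "\<lambda>x. q x mod L" p L x] \<open>coprime p L\<close> by simp
  then show ?thesis by (simp add: q_def mod_eq_dvd_iff)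
qed

lemma F_period_infinite:
  assumes "m \<ge> 1" "N \<ge> 1" "n \<ge> 2" "n dvd N" "coprime n (2 * m + 1)"
  shows "F_period (2 * m + 1) N = \<infinity>"
  unfolding F_period_eq_infinity_iff
proof (intro allI impI notI)
  fix T assume "T \<ge> 1" and one: "F_walk (2 * m + 1) N ^\<^sub>m T = 1\<^sub>m (N * (2 * m + 1))"
  let ?L = "2 * int m + 1"
  \<comment> \<open>This \<open>g\<close> has period \<open>n\<close>, which is coprime to
    \<open>L\<close>, and hence period \<open>N\<close>; yet it separates 0 from 1, as
    \<open>n\<close> is at least 2.\<close>
  define g :: "int \<Rightarrow> int" where "g = (\<lambda>x. if x mod int n = 0 then 1 else 0)"
  have g: "periodic_fun_simple g (int n)"
    by unfold_locales (simp add: g_def)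
  have coprime: "coprime (int n) ?L"
  proof -
    have "?L = int (2 * m + 1)" by simp
    then show ?thesis using assms(5) by (simp only: coprime_int_iff)
  qed
  have gN: "g (x + int N) = g x" for x
    using periodic_cong_mod[OF g, of "x + int N" x] \<open>n dvd N\<close> by (simp add: mod_eq_dvd_iff)
  have "x + int N - j = x - j + int N" for x j :: int by simp
  then have "periodic_fun_simple (\<lambda>x j. complex_of_int (g (x - j))) (int N)"
    using gN by unfold_locales (metis (no_types))
  \<comment> \<open>At displacement 0 both parts of the state are evaluated at the same point
    \<open>x\<close>.\<close>
  then have walk: "(walk_step m ^^ T) (\<lambda>x j. complex_of_int (g (x - j))) x 0 = of_int (g x)" for x
    using one unfolding F_walk_power_eq_one_iff[OF \<open>N \<ge> 1\<close>] by simp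
  have "complex_of_int (scaled_amp m g (Suc T) x - ?L * scaled_amp m g T x) = of_int (g x * ?L ^ T)" for x
  proof -
    have "of_nat (2 * m + 1) = complex_of_int ?L" by simp
    moreover have "complex_of_int ?L \<noteq> 0" unfolding of_int_eq_0_iff by linarith
    ultimately show ?thesis
      using walk[of x] unfolding walk_power_scaled_amp
      by (simp only: divide_eq_eq power_eq_0_iff of_int_mult of_int_power diff_zero) simp
  qed
  then have amp: "scaled_amp m g (Suc T) x - ?L * scaled_amp m g T x = g x * ?L ^ T" for x
    by (metis of_int_eq_iff)
  \<comment> \<open>The term at time \<open>T\<close> carries a factor \<open>?L\<close>, and so
    does \<open>?L ^ T\<close> because \<open>T\<close> is positive. The last amplitude therefore
    vanishes modulo \<open>?L\<close>, which starts the descent.\<close>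
  have "?L dvd scaled_amp m g (Suc T) x" for x
  proof -
    have "?L dvd g x * ?L ^ T" using \<open>T \<ge> 1\<close> by (simp add: dvd_power)
    then show ?thesis unfolding amp[symmetric] by (simp only: dvd_diff_left_iff[OF dvd_triv_left])
  qed
  then have "?L dvd scaled_amp m g (Suc T) (x + 1) - scaled_amp m g (Suc T) x" for x
    by (intro dvd_diff)
  \<comment> \<open>Each descent lowers the time index by one, ending at index \<open>Suc 0\<close>,
    where the amplitude is \<open>g\<close>.\<close>
  then have "?L dvd scaled_amp m g (Suc 0) (x + 1) - scaled_amp m g (Suc 0) x" for x
  proof (induction T arbitrary: x)
    case (Suc T)
    from scaled_amp_descent[OF g coprime Suc.prems] show ?case by (rule Suc.IH)
  qed
  from this[of 0] have "?L dvd g 1 - g 0" by simp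
  moreover have "g 1 - g 0 = - 1" using \<open>n \<ge> 2\<close> by (simp add: g_def)
  ultimately have "?L dvd 1" by (metis dvd_minus_iff)
  then show False using \<open>m \<ge> 1\<close> by simp
qed

theorem theorem4p10:
  fixes L :: nat
  assumes "L \<ge> 3" and "odd L"
  shows "F_period L L = 4 \<and>
    (\<forall>N\<ge>2. (\<exists>n\<ge>2. n dvd N \<and> coprime n L) \<longrightarrow> F_period L N = \<infinity>)"
proof -
  obtain m where L: "L = 2 * m + 1" using assms(2) by (rule oddE)
  then have "m \<ge> 1" using assms(1) by simp
  then show ?thesis
    unfolding L using F_period_diagonal F_period_infinite by force
qed

end
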